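(* Let $V=f+g-h$ satisfy the standing assumptions (a)–(e) of the context, and let $w$ be a local minimum of $\min_{z\in\mathbb{E}}V(z)$. Then: (1) $w$ is a local minimum of $f_i+g_j-h_m$ for all $(i,j,m)\in I\times J\times M$ such that $w\in D_i(f)\cap D_j(g)\cap D_m(h)$; (2) there exists $\varepsilon\in(0,1/L)$, dependent on $w$, such that $w\in\mathrm{Fix}(T^\lambda_{\rm PDMC})$ for any $\lambda\in(0,\min\{\bar\lambda,\varepsilon\}]$; and (3) if $w$ is a global minimum of $V$, then $T^\lambda_{\rm PDMC}$ is single-valued at $w$ and $w\in\mathrm{Fix}(T^\lambda_{\rm PDMC})$, for all $\lambda\in(0,\min\{\bar\lambda,1/L\})$.
   Context: $\mathbb{E}$ is a Euclidean space with norm $\|\cdot\|$. A function $q$ is $\rho$-convex ($\rho\in\mathbb{R}$) if $q-\frac{\rho}{2}\|\cdot\|^2$ is convex. $\mathrm{dom}(q)=\{w:q(w)<+\infty\}$. Local/global minima of $V$ are understood to lie in $\mathrm{dom}(g)$. $\mathrm{Fix}(T)=\{w: w\in T(w)\}$. Standing assumptions: (a) $f=\min_{i\in I}f_i$, $g=\min_{j\in J}g_j$, $h=\max_{m\in M}h_m$ with $I,J,M$ finite index sets. (b) For each $i\in I$, $f_i:\mathbb{E}\to\mathbb{R}$ has $L_i$-Lipschitz continuous gradient in $\mathbb{E}$ for some $L_i>0$; put $L=\max_{i\in I}L_i$. (c) For each $j\in J$, $g_j:\mathbb{E}\to\mathbb{R}\cup\{+\infty\}$ is proper and $\rho$-convex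 (with common $\rho\in\mathbb{R}$), $\mathrm{dom}(g_j)$ is closed, and $g_j$ is continuous in $\mathrm{dom}(g_j)$. (d) For each $m\in M$, $h_m:\mathbb{E}\to\mathbb{R}$ is a continuously differentiable convex function. (e) For all $(i,j,m)\in I\times J\times M$, $f_i+g_j-h_m$ is coercive over $\mathbb{E}$. $\bar\lambda=-1/\rho$ if $\rho<0$ and $\bar\lambda=+\infty$ if $\rho\ge0$. Operator: $D_i(f)=\{w\in\mathbb{E}: f(w)=f_i(w)\}$, $D_j(g)=\{w\in\mathrm{dom}(g): g(w)=g_j(w)\}$, $D_m(h)=\{w\in\mathbb{E}: h(w)=h_m(w)\}$, $f'(w)=\{\nabla f_i(w): i\in I,\ w\in D_i(f)\}$, $h'(w)=\{\nabla h_m(w): m\in M,\ w\in D_m(h)\}$, $\mathrm{prox}_{\lambda g}(w)=\arg\min_{z\in\mathbb{E}}\{g(z)+\frac{1}{2\lambda}\|z-w\|^2\}$ (possibly set-valued), and $$T^\lambda_{\rm PDMC}(w)=\mathrm{prox}_{\lambda g}\big(w-\lambda f'(w)+\lambda h'(w)\big)=\bigcup_{u\in f'(w),\,v\in h'(w)}\mathrm{prox}_{\lambda g}(w-\lambda u+\lambda v).$$ *)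

theory Defs
  imports "HOL-Analysis.Analysis"
begin

text \<open>Functions into \<open>\<real> \<union> {+\<infinity>}\<close> are modelled as \<^typ>\<open>ereal\<close>-valued functions
  that never take the value \<open>-\<infinity>\<close>; the latter is part of \<open>proper_fun\<close>.\<close>

definition eff_dom :: "('a \<Rightarrow> ereal) \<Rightarrow> 'a set" where
  "eff_dom q = {w. q w < \<infinity>}"

definition proper_fun :: "('a \<Rightarrow> ereal) \<Rightarrow> bool" where
  "proper_fun q \<longleftrightarrow> (\<forall>w. q w \<noteq> -\<infinity>) \<and> eff_dom q \<noteq> {}"

text \<open>The library's \<^const>\<open>convex_on\<close> covers real-valued functions only. At \<open>t = 0\<close> and
  \<open>t = 1\<close> the inequality is trivial, since \<open>0 * \<infinity> = 0\<close> in \<^typ>\<open>ereal\<close>.\<close>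

definition ereal_convex :: "('a::real_vector \<Rightarrow> ereal) \<Rightarrow> bool" where
  "ereal_convex q \<longleftrightarrow>
     (\<forall>x y. \<forall>t\<in>{0..1::real}.
        q ((1 - t) *\<^sub>R x + t *\<^sub>R y) \<le> ereal (1 - t) * q x + ereal t * q y)"

definition rho_convex :: "real \<Rightarrow> ('a::real_normed_vector \<Rightarrow> ereal) \<Rightarrow> bool" where
  "rho_convex \<rho> q \<longleftrightarrow> ereal_convex (\<lambda>w. q w - ereal (\<rho> / 2 * (norm w)\<^sup>2))"

definition coercive :: "('a::real_normed_vector \<Rightarrow> ereal) \<Rightarrow> bool" where
  "coercive q \<longleftrightarrow> (q \<longlongrightarrow> \<infinity>) at_infinity"

definition has_gradients :: "('a::real_inner \<Rightarrow> real) \<Rightarrow> bool" where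
  "has_gradients q \<longleftrightarrow> (\<forall>w. \<exists>d. GDERIV q w :> d)"

text \<open>Meaningful only where \<open>q\<close> is differentiable.\<close>

definition gradient :: "('a::real_inner \<Rightarrow> real) \<Rightarrow> 'a \<Rightarrow> 'a" where
  "gradient q w = (THE d. GDERIV q w :> d)"

definition min_fun :: "'i set \<Rightarrow> ('i \<Rightarrow> 'a \<Rightarrow> 'b::linorder) \<Rightarrow> 'a \<Rightarrow> 'b" where
  "min_fun I q w = Min ((\<lambda>i. q i w) ` I)"

definition max_fun :: "'i set \<Rightarrow> ('i \<Rightarrow> 'a \<Rightarrow> 'b::linorder) \<Rightarrow> 'a \<Rightarrow> 'b" where
  "max_fun I q w = Max ((\<lambda>i. q i w) ` I)"

definition composite :: "('a \<Rightarrow> real) \<Rightarrow> ('a \<Rightarrow> ereal) \<Rightarrow> ('a \<Rightarrow> real) \<Rightarrow> 'a \<Rightarrow> ereal" where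
  "composite f g h w = ereal (f w) + g w - ereal (h w)"

text \<open>Minima are required to lie in the effective domain. For \<open>composite f g h\<close> with \<open>f\<close>, \<open>h\<close>
  real-valued, this is the effective domain of \<open>g\<close>.\<close>

definition local_minimum :: "('a::topological_space \<Rightarrow> ereal) \<Rightarrow> 'a \<Rightarrow> bool" where
  "local_minimum q w \<longleftrightarrow> w \<in> eff_dom q \<and> eventually (\<lambda>z. q w \<le> q z) (nhds w)"

definition global_minimum :: "('a \<Rightarrow> ereal) \<Rightarrow> 'a \<Rightarrow> bool" where
  "global_minimum q w \<longleftrightarrow> w \<in> eff_dom q \<and> (\<forall>z. q w \<le> q z)"

text \<open>\<open>D_real f (f\<^sub>i)\<close> is \<open>D\<^sub>i(f)\<close> (likewise \<open>D\<^sub>m(h)\<close>), and \<open>D_ereal g (g\<^sub>j)\<close> is \<open>D\<^sub>j(g)\<close>.\<close>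

definition D_real :: "('a \<Rightarrow> real) \<Rightarrow> ('a \<Rightarrow> real) \<Rightarrow> 'a set" where
  "D_real q p = {w. q w = p w}"

definition D_ereal :: "('a \<Rightarrow> ereal) \<Rightarrow> ('a \<Rightarrow> ereal) \<Rightarrow> 'a set" where
  "D_ereal q p = {w \<in> eff_dom q. q w = p w}"

text \<open>The set-valued derivatives: \<open>f' = active_gradients I fs (min_fun I fs)\<close> and
  \<open>h' = active_gradients M hs (max_fun M hs)\<close>.\<close>

definition active_gradients ::
  "'i set \<Rightarrow> ('i \<Rightarrow> 'a::real_inner \<Rightarrow> real) \<Rightarrow> ('a \<Rightarrow> real) \<Rightarrow> 'a \<Rightarrow> 'a set" where
  "active_gradients I qs q w = {gradient (qs i) w | i. i \<in> I \<and> w \<in> D_real q (qs i)}"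

definition prox :: "real \<Rightarrow> ('a::real_normed_vector \<Rightarrow> ereal) \<Rightarrow> 'a \<Rightarrow> 'a set" where
  "prox lam g w =
     {z. \<forall>y. g z + ereal (1 / (2 * lam) * (norm (z - w))\<^sup>2)
              \<le> g y + ereal (1 / (2 * lam) * (norm (y - w))\<^sup>2)}"

definition T_PDMC ::
  "'i set \<Rightarrow> ('i \<Rightarrow> 'a::real_inner \<Rightarrow> real) \<Rightarrow> 'j set \<Rightarrow> ('j \<Rightarrow> 'a \<Rightarrow> ereal) \<Rightarrow>
   'm set \<Rightarrow> ('m \<Rightarrow> 'a \<Rightarrow> real) \<Rightarrow> real \<Rightarrow> 'a \<Rightarrow> 'a set" where
  "T_PDMC I fs J gs M hs lam w =
     (\<Union>u \<in> active_gradients I fs (min_fun I fs) w.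
        \<Union>v \<in> active_gradients M hs (max_fun M hs) w.
          prox lam (min_fun J gs) (w - lam *\<^sub>R u + lam *\<^sub>R v))"

definition Fix :: "('a \<Rightarrow> 'a set) \<Rightarrow> 'a set" where
  "Fix T = {w. w \<in> T w}"

definition lambda_bar :: "real \<Rightarrow> ereal" where
  "lambda_bar \<rho> = (if \<rho> < 0 then ereal (- 1 / \<rho>) else \<infinity>)"

end

theory Submission
  imports Defs
begin

text \<open>If \<open>V\<close> is minorized by \<open>V w - a \<parallel>z - w\<parallel>\<^sup>2\<close>, then the descent lemma for an active \<open>f\<^sub>i\<close> and the
  tangent inequality for an active \<open>h\<^sub>m\<close> turn this into a quadratic minorization of \<open>g\<close>, which says
  that \<open>w\<close> is the unique minimizer in the proximal subproblem as soon as \<open>1 / \<lambda> > L + 2 a\<close>.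
  At a global minimum \<open>a = 0\<close> works. At a local minimum some \<open>a\<close> works because \<open>V\<close> is bounded
  below by coercivity, so the minorization away from \<open>w\<close> holds for large \<open>a\<close>.\<close>

section \<open>Gradients and first-order inequalities\<close>

lemma GDERIV_gradient:
  assumes "has_gradients q"
  shows "GDERIV q x :> gradient q x"
proof -
  obtain d where d: "GDERIV q x :> d"
    using assms unfolding has_gradients_def by blast
  have "d' = d" if "GDERIV q x :> d'" for d'
  proof -
    have "(\<lambda>h. inner h d') = (\<lambda>h. inner h d)"
      using that d unfolding gderiv_def by (rule has_derivative_unique)
    \<comment> \<open>Testing both functionals in the direction \<open>d' - d\<close> leaves the
      squared norm of \<open>d' - d\<close> equal to zero.\<close>
    then have "inner (d' - d) d' = inner (d' - d) d" by meson
    then show ?thesis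
      by (metis inner_eq_zero_iff inner_diff_right eq_iff_diff_eq_0)
  qed
  then show ?thesis
    unfolding gradient_def using d by (metis theI)
qed

lemma gradient_along_line:
  assumes "has_gradients q"
  shows "((\<lambda>t. q (x + t *\<^sub>R d)) has_real_derivative inner d (gradient q (x + t *\<^sub>R d))) (at t)"
proof -
  have q: "(q has_derivative (\<lambda>h. inner h (gradient q (x + t *\<^sub>R d)))) (at (x + t *\<^sub>R d))"
    using GDERIV_gradient[OF assms] by (simp add: gderiv_def)
  have l: "((\<lambda>t. x + t *\<^sub>R d) has_derivative (\<lambda>s. s *\<^sub>R d)) (at t)"
    by (auto intro!: derivative_eq_intros)
  show ?thesis
    using has_derivative_compose[OF l q]
    unfolding has_field_derivative_def by (simp add: mult_commute_abs)
qed

text \<open>Along the segment, \<open>\<phi>\<close> is \<open>q\<close> minus the non-constant part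
  of its quadratic model. By Cauchy-Schwarz and the Lipschitz bound its derivative is nonpositive
  for \<open>t \<ge> 0\<close>, and the claim is \<open>\<phi> 1 \<le> \<phi> 0\<close>.\<close>

lemma descent_lemma:
  assumes q: "has_gradients q" and lip: "K-lipschitz_on UNIV (gradient q)"
  shows "q y \<le> q x + inner (y - x) (gradient q x) + K / 2 * (norm (y - x))\<^sup>2"
proof -
  define d where "d = y - x"
  define \<phi> where "\<phi> t = q (x + t *\<^sub>R d) - t * inner d (gradient q x) - K / 2 * t\<^sup>2 * (norm d)\<^sup>2" for t
  have der: "(\<phi> has_real_derivative
      inner d (gradient q (x + t *\<^sub>R d)) - inner d (gradient q x) - K * t * (norm d)\<^sup>2) (at t)" for t
    unfolding \<phi>_def
    by (rule derivative_eq_intros gradient_along_line[OF q] refl | simp)+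
  have "inner d (gradient q (x + t *\<^sub>R d)) - inner d (gradient q x) - K * t * (norm d)\<^sup>2 \<le> 0"
    if "0 \<le> t" for t
  proof -
    have "inner d (gradient q (x + t *\<^sub>R d) - gradient q x)
        \<le> norm d * norm (gradient q (x + t *\<^sub>R d) - gradient q x)"
      by (rule norm_cauchy_schwarz)
    also have "\<dots> \<le> norm d * (K * norm (t *\<^sub>R d))"
      using lipschitz_onD[OF lip, of "x + t *\<^sub>R d" x]
      by (intro mult_left_mono) (auto simp: dist_norm)
    also have "\<dots> = K * t * (norm d)\<^sup>2"
      using that by (simp add: power2_eq_square)
    finally show ?thesis by (simp add: inner_diff_right)
  qed
  then have "\<phi> 1 \<le> \<phi> 0"
    using der by (intro DERIV_nonpos_imp_nonincreasing[of 0 1 \<phi>]) (simp, blast)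
  then show ?thesis by (simp add: \<phi>_def d_def)
qed

text \<open>Restricting \<open>q\<close> to the line through \<open>x\<close> and \<open>y\<close>
  reduces this to the tangent inequality in one variable, at parameter 0 and evaluated at 1.\<close>

lemma convex_above_gradient:
  assumes q: "has_gradients q" and cvx: "convex_on UNIV q"
  shows "q x + inner (y - x) (gradient q x) \<le> q y"
proof -
  define \<phi> where "\<phi> t = q (x + t *\<^sub>R (y - x))" for t
  have "convex_on UNIV \<phi>"
  proof (rule convex_onI)
    fix t a b :: real assume t: "0 < t" "t < 1"
    have "x + ((1 - t) *\<^sub>R a + t *\<^sub>R b) *\<^sub>R (y - x)
        = (1 - t) *\<^sub>R (x + a *\<^sub>R (y - x)) + t *\<^sub>R (x + b *\<^sub>R (y - x))"
      by (simp add: algebra_simps)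
    then show "\<phi> ((1 - t) *\<^sub>R a + t *\<^sub>R b) \<le> (1 - t) * \<phi> a + t * \<phi> b"
      unfolding \<phi>_def using convex_onD[OF cvx, of t] t by simp
  qed simp
  moreover have "(\<phi> has_real_derivative inner (y - x) (gradient q x)) (at 0)"
    unfolding \<phi>_def using gradient_along_line[OF q, of x "y - x" 0] by simp
  ultimately have "\<phi> 1 - \<phi> 0 \<ge> inner (y - x) (gradient q x) * (1 - 0)"
    by (intro convex_on_imp_above_tangent[of UNIV]) auto
  then show ?thesis by (simp add: \<phi>_def)
qed

section \<open>Lower bounds and the proximal subproblem\<close>

lemma has_gradients_continuous:
  assumes "has_gradients q"
  shows "continuous_on S q"
proof -
  have "isCont q x" for x
    using GDERIV_gradient[OF assms] unfolding gderiv_def by (rule has_derivative_continuous)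
  then show ?thesis by (simp add: continuous_at_imp_continuous_on)
qed

text \<open>Three regions cover the space: far from the origin coercivity gives positive values,
  outside \<open>eff_dom g\<close> the value is infinite, and the rest is compact with a continuous
  real-valued restriction.\<close>

lemma composite_bounded_below:
  fixes g :: "'a::euclidean_space \<Rightarrow> ereal"
  assumes proper: "proper_fun g" and closed: "closed (eff_dom g)"
    and cont_g: "continuous_on (eff_dom g) g"
    and cont_f: "continuous_on UNIV f" and cont_h: "continuous_on UNIV h"
    and coercive: "coercive (composite f g h)"
  obtains B where "\<And>z. ereal B \<le> composite f g h z"
proof -
  have "eventually (\<lambda>z. 0 < composite f g h z) at_infinity"
    using coercive unfolding coercive_def by (rule order_tendstoD) simp
  then obtain R where R: "\<And>z. R \<le> norm z \<Longrightarrow> 0 < composite f g h z"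
    unfolding eventually_at_infinity by blast
  define S where "S = eff_dom g \<inter> cball 0 R"
  have S: "compact S"
    unfolding S_def using closed by (intro closed_Int_compact) auto
  have gS: "g z = ereal (real_of_ereal (g z))" if "z \<in> S" for z
    using that proper by (cases "g z") (auto simp: S_def eff_dom_def proper_fun_def)
  define \<phi> where "\<phi> z = f z + real_of_ereal (g z) - h z" for z
  have "continuous_on S (\<lambda>z. real_of_ereal (g z))"
  proof -
    have "continuous_on S g"
      using cont_g by (rule continuous_on_subset) (simp add: S_def)
    \<comment> \<open>On \<open>S\<close> the values are finite, and limits of \<open>ereal\<close>
      images with a real limit are limits of the underlying reals.\<close>
    then have "continuous_on S (\<lambda>z. ereal (real_of_ereal (g z)))"
      by (rule continuous_on_eq) (rule gS)
    then show ?thesis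
      by (simp add: continuous_on_def)
  qed
  then have "continuous_on S \<phi>"
    unfolding \<phi>_def using cont_f cont_h
    by (intro continuous_intros) (auto intro: continuous_on_subset)
  then have "bounded (\<phi> ` S)"
    using S compact_continuous_image compact_imp_bounded by blast
  then obtain b where b: "\<And>z. z \<in> S \<Longrightarrow> \<bar>\<phi> z\<bar> \<le> b"
    unfolding bounded_iff by auto
  \<comment> \<open>The bound \<open>- b\<close> serves on \<open>S\<close>, the bound 0 outside the
    ball.\<close>
  have "ereal (min 0 (- b)) \<le> composite f g h z" for z
  proof (cases "z \<in> S")
    case True
    then have "composite f g h z = ereal (\<phi> z)"
      using gS[OF True] unfolding composite_def \<phi>_def
      by (metis ereal_minus(1) plus_ereal.simps(1))
    then show ?thesis using b[OF True] by auto
  next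
    case False
    then consider "R \<le> norm z" | "g z = \<infinity>"
      by (auto simp: S_def eff_dom_def)
    then show ?thesis
    proof cases
      case 1
      have "ereal (min 0 (- b)) \<le> 0" by (simp add: zero_ereal_def)
      then show ?thesis using R[OF 1] by order
    qed (simp add: composite_def)
  qed
  then show thesis by (rule that)
qed

text \<open>Expanding the proximal square about \<open>w\<close> yields the linear term
  \<open>inner (z - w) s\<close>, the same one that the descent and tangent inequalities produce.
  What remains is quadratic growth of the proximal objective away from \<open>w\<close>, which gives
  both optimality and uniqueness.\<close>

lemma prox_eq_singleton:
  fixes f h p q :: "'a::real_inner \<Rightarrow> real"
  assumes p: "has_gradients p" "K-lipschitz_on UNIV (gradient p)"
    and q: "has_gradients q" "convex_on UNIV q"
    and active: "f w = p w" "h w = q w"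
    and bounds: "\<And>z. f z \<le> p z" "\<And>z. q z \<le> h z"
    and Vw: "composite f g h w = ereal c"
    and minor: "\<And>z. ereal (c - a * (norm (z - w))\<^sup>2) \<le> composite f g h z"
    and lam: "0 < lam" "K / 2 + a < 1 / (2 * lam)"
  shows "prox lam g (w - lam *\<^sub>R gradient p w + lam *\<^sub>R gradient q w) = {w}"
proof -
  define s where "s = gradient p w - gradient q w"
  define \<alpha> where "\<alpha> z = 1 / (2 * lam) * (norm (z - (w - lam *\<^sub>R gradient p w + lam *\<^sub>R gradient q w)))\<^sup>2" for z
  \<comment> \<open>The proximal quadratic coefficient, less \<open>K / 2\<close> spent on the
    descent lemma and \<open>a\<close> spent on the minorization.\<close>
  define \<beta> where "\<beta> = 1 / (2 * lam) - K / 2 - a"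
  have \<beta>: "\<beta> > 0" using lam by (simp add: \<beta>_def)
  have \<alpha>: "\<alpha> z = 1 / (2 * lam) * (norm (z - w))\<^sup>2 + inner (z - w) s + \<alpha> w" for z
  proof -
    have *: "y - (w - lam *\<^sub>R gradient p w + lam *\<^sub>R gradient q w) = (y - w) + lam *\<^sub>R s" for y
      by (simp add: s_def algebra_simps)
    have "(norm ((z - w) + lam *\<^sub>R s))\<^sup>2
        = (norm (z - w))\<^sup>2 + 2 * lam * inner (z - w) s + (norm (lam *\<^sub>R s))\<^sup>2"
      unfolding power2_norm_eq_inner by (simp add: inner_add_left inner_add_right inner_commute)
    then show ?thesis unfolding \<alpha>_def * using lam by (simp add: field_simps)
  qed
  obtain r where r: "g w = ereal r" "f w + r - h w = c"
    using Vw by (cases "g w") (auto simp: composite_def)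
  have growth: "ereal (r + \<alpha> w + \<beta> * (norm (z - w))\<^sup>2) \<le> g z + ereal (\<alpha> z)" for z
  proof (cases "g z")
    case (real t)
    have "c - a * (norm (z - w))\<^sup>2 \<le> f z + t - h z"
      using minor[of z] real by (simp add: composite_def)
    also have "\<dots> \<le> p z + t - q z" using bounds[of z] by simp
    also have "\<dots> \<le> p w - q w + inner (z - w) s + K / 2 * (norm (z - w))\<^sup>2 + t"
      using descent_lemma[OF p, of z w] convex_above_gradient[OF q, of w z]
      by (simp add: s_def inner_diff_right)
    finally have "r + \<beta> * (norm (z - w))\<^sup>2 \<le> t + inner (z - w) s + 1 / (2 * lam) * (norm (z - w))\<^sup>2"
      using r(2) active by (simp add: \<beta>_def algebra_simps)
    then show ?thesis using \<alpha>[of z] real by simp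
  next
    \<comment> \<open>The value \<open>-\<infinity>\<close> would carry over to the composite and
      contradict the real lower bound \<open>minor\<close>.\<close>
    case MInf
    then show ?thesis using minor[of z] by (simp add: composite_def)
  qed simp
  have "w \<in> prox lam g (w - lam *\<^sub>R gradient p w + lam *\<^sub>R gradient q w)"
  proof -
    have "g w + ereal (\<alpha> w) \<le> g z + ereal (\<alpha> z)" for z
      using growth[of z] \<beta> r(1) by (elim order_trans[rotated]) simp
    then show ?thesis by (simp add: prox_def \<alpha>_def)
  qed
  moreover have "z = w" if "z \<in> prox lam g (w - lam *\<^sub>R gradient p w + lam *\<^sub>R gradient q w)" for z
  proof -
    have "g z + ereal (\<alpha> z) \<le> g w + ereal (\<alpha> w)"
      using that unfolding prox_def \<alpha>_def by blast
    with growth[of z] have "ereal (r + \<alpha> w + \<beta> * (norm (z - w))\<^sup>2) \<le> ereal (r + \<alpha> w)"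
      using r(1) by (metis order_trans plus_ereal.simps(1))
    then have "\<beta> * (norm (z - w))\<^sup>2 \<le> 0" by simp
    then show ?thesis using \<beta> by (simp add: mult_le_0_iff)
  qed
  ultimately show ?thesis by blast
qed

section \<open>Pointwise minima and maxima of finite families\<close>

lemma composite_mono:
  assumes "f z \<le> f' z" "g z \<le> g' z" "h' z \<le> h z"
  shows "composite f g h z \<le> composite f' g' h' z"
  unfolding composite_def using assms by (intro ereal_minus_mono add_mono) auto

lemma min_fun_le: "finite I \<Longrightarrow> i \<in> I \<Longrightarrow> min_fun I q z \<le> q i z"
  by (simp add: min_fun_def)

lemma max_fun_ge: "finite I \<Longrightarrow> i \<in> I \<Longrightarrow> q i z \<le> max_fun I q z"
  by (simp add: max_fun_def)

lemma min_fun_attained: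
  assumes "finite I" "I \<noteq> {}"
  obtains i where "i \<in> I" "min_fun I q z = q i z"
proof -
  have "min_fun I q z \<in> (\<lambda>i. q i z) ` I"
    unfolding min_fun_def using assms by (intro Min_in) auto
  then show thesis using that by blast
qed

lemma max_fun_attained:
  assumes "finite I" "I \<noteq> {}"
  obtains i where "i \<in> I" "max_fun I q z = q i z"
proof -
  have "max_fun I q z \<in> (\<lambda>i. q i z) ` I"
    unfolding max_fun_def using assms by (intro Max_in) auto
  then show thesis using that by blast
qed

section \<open>Minima of the composite objective and fixed points of the PDMC operator\<close>

theorem theorem5p10:
  fixes I :: "'i set" and J :: "'j set" and M :: "'m set"
    and fs :: "'i \<Rightarrow> 'a::euclidean_space \<Rightarrow> real"
    and gs :: "'j \<Rightarrow> 'a \<Rightarrow> ereal"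
    and hs :: "'m \<Rightarrow> 'a \<Rightarrow> real"
    and Ls :: "'i \<Rightarrow> real" and L \<rho> :: real
    and f h :: "'a \<Rightarrow> real" and g V :: "'a \<Rightarrow> ereal"
    and w :: 'a
  assumes "finite I" "I \<noteq> {}" "finite J" "J \<noteq> {}" "finite M" "M \<noteq> {}"
    and f_def: "f = min_fun I fs"
    and g_def: "g = min_fun J gs"
    and h_def: "h = max_fun M hs"
    and V_def: "V = composite f g h"
    and fs: "\<And>i. i \<in> I \<Longrightarrow>
          Ls i > 0 \<and> has_gradients (fs i) \<and> (Ls i)-lipschitz_on UNIV (gradient (fs i))"
    and L_def: "L = Max (Ls ` I)"
    and gs: "\<And>j. j \<in> J \<Longrightarrow>
          proper_fun (gs j) \<and> rho_convex \<rho> (gs j) \<and> closed (eff_dom (gs j)) \<and>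
          continuous_on (eff_dom (gs j)) (gs j)"
    and hs: "\<And>m. m \<in> M \<Longrightarrow>
          has_gradients (hs m) \<and> continuous_on UNIV (gradient (hs m)) \<and> convex_on UNIV (hs m)"
    and coercive: "\<And>i j m. i \<in> I \<Longrightarrow> j \<in> J \<Longrightarrow> m \<in> M \<Longrightarrow>
          coercive (composite (fs i) (gs j) (hs m))"
    and w: "local_minimum V w"
  shows "(\<forall>i\<in>I. \<forall>j\<in>J. \<forall>m\<in>M. w \<in> D_real f (fs i) \<inter> D_ereal g (gs j) \<inter> D_real h (hs m) \<longrightarrow>
            local_minimum (composite (fs i) (gs j) (hs m)) w)
       \<and> (\<exists>\<epsilon>. 0 < \<epsilon> \<and> \<epsilon> < 1 / L \<and>
            (\<forall>lam. 0 < lam \<and> ereal lam \<le> min (lambda_bar \<rho>) (ereal \<epsilon>) \<longrightarrow>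
                 w \<in> Fix (T_PDMC I fs J gs M hs lam)))
       \<and> (global_minimum V w \<longrightarrow>
            (\<forall>lam. 0 < lam \<and> ereal lam < min (lambda_bar \<rho>) (ereal (1 / L)) \<longrightarrow>
                 is_singleton (T_PDMC I fs J gs M hs lam w) \<and>
                 w \<in> Fix (T_PDMC I fs J gs M hs lam)))"
proof -
  have Li: "Ls i \<le> L" if "i \<in> I" for i
    using that \<open>finite I\<close> by (simp add: L_def)
  have L: "L > 0"
    using \<open>I \<noteq> {}\<close> fs Li by (meson all_not_in_conv less_le_trans)
  \<comment> \<open>With \<open>V_attained\<close>, this makes \<open>V\<close> the pointwise
    minimum of finitely many composites, so a lower bound for each of them yields one for
    \<open>V\<close>.\<close>
  have V_le: "V z \<le> composite (fs i) (gs j) (hs m) z" if "i \<in> I" "j \<in> J" "m \<in> M" for i j m z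
    unfolding V_def f_def g_def h_def
    using that assms(1,3,5) by (intro composite_mono min_fun_le max_fun_ge) auto
  have V_attained: "\<exists>i\<in>I. \<exists>j\<in>J. \<exists>m\<in>M. V z = composite (fs i) (gs j) (hs m) z" for z
  proof -
    obtain i j m where "i \<in> I" "f z = fs i z" "j \<in> J" "g z = gs j z" "m \<in> M" "h z = hs m z"
      unfolding f_def g_def h_def
      by (metis min_fun_attained max_fun_attained assms(1-6))
    then show ?thesis unfolding V_def composite_def by metis
  qed

  have "\<exists>B. \<forall>z. ereal B \<le> composite (fs i) (gs j) (hs m) z" if "i \<in> I" "j \<in> J" "m \<in> M" for i j m
    using that fs[of i] gs[of j] hs[of m] coercive[of i j m]
    by (metis composite_bounded_below has_gradients_continuous)
  then obtain B where B: "\<And>i j m z. i \<in> I \<Longrightarrow> j \<in> J \<Longrightarrow> m \<in> M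
      \<Longrightarrow> ereal (B i j m) \<le> composite (fs i) (gs j) (hs m) z"
    by metis
  define b where "b = Min ((\<lambda>(i, j, m). B i j m) ` (I \<times> J \<times> M))"
  have b: "ereal b \<le> V z" for z
  proof -
    obtain i j m where ijm: "i \<in> I" "j \<in> J" "m \<in> M" "V z = composite (fs i) (gs j) (hs m) z"
      using V_attained by blast
    have "b \<le> B i j m"
      unfolding b_def using ijm assms(1,3,5) by (intro Min_le) (auto intro!: image_eqI[of _ _ "(i, j, m)"])
    then show ?thesis
      using B[OF ijm(1-3), of z] ijm(4) by (metis ereal_less_eq(3) order_trans)
  qed
  \<comment> \<open>Membership in the effective domain excludes \<open>\<infinity>\<close>, and the
    bound \<open>b\<close> excludes \<open>-\<infinity>\<close>.\<close>
  obtain c where c: "V w = ereal c"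
    using w b[of w] by (cases "V w") (auto simp: local_minimum_def eff_dom_def)

  \<comment> \<open>The minorization concerns \<open>V\<close> alone, so it serves every pair of
    active gradients: each contributes the same set \<open>{w}\<close>, and the union collapses.
    \<open>Ls i \<le> L\<close> makes one condition on \<open>lam\<close> suffice for all
    \<open>i\<close>.\<close>
  have T: "T_PDMC I fs J gs M hs lam w = {w}"
    if minor: "\<And>z. ereal (c - a * (norm (z - w))\<^sup>2) \<le> V z"
      and lam: "0 < lam" "L / 2 + a < 1 / (2 * lam)" for a lam
  proof -
    have prox: "prox lam g (w - lam *\<^sub>R u + lam *\<^sub>R v) = {w}"
      if uv: "u \<in> active_gradients I fs f w" "v \<in> active_gradients M hs h w" for u v
    proof -
      obtain i m where im: "i \<in> I" "f w = fs i w" "u = gradient (fs i) w"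
        "m \<in> M" "h w = hs m w" "v = gradient (hs m) w"
        using uv unfolding active_gradients_def D_real_def by auto
      have bounds: "f z \<le> fs i z" "hs m z \<le> h z" for z
        unfolding f_def h_def using im assms(1,5) by (auto intro: min_fun_le max_fun_ge)
      show ?thesis
        unfolding im(3,6)
        by (rule prox_eq_singleton[where f = f and h = h and K = "Ls i" and c = c and a = a])
          (use im fs hs c minor lam Li[OF im(1)] bounds in \<open>auto simp: V_def\<close>)
    qed
    \<comment> \<open>Without an active index on each side the union would be empty instead of
      \<open>{w}\<close>.\<close>
    have "active_gradients I fs f w \<noteq> {}"
      unfolding active_gradients_def D_real_def f_def
      using min_fun_attained[OF assms(1,2)] by (metis (mono_tags, lifting) empty_Collect_eq mem_Collect_eq)
    moreover have "active_gradients M hs h w \<noteq> {}"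
      unfolding active_gradients_def D_real_def h_def
      using max_fun_attained[OF assms(5,6)] by (metis (mono_tags, lifting) empty_Collect_eq mem_Collect_eq)
    ultimately show ?thesis
      unfolding T_PDMC_def f_def[symmetric] g_def[symmetric] h_def[symmetric]
      using prox by simp
  qed

  have 1: "local_minimum (composite (fs i) (gs j) (hs m)) w"
    if "i \<in> I" "j \<in> J" "m \<in> M" "w \<in> D_real f (fs i) \<inter> D_ereal g (gs j) \<inter> D_real h (hs m)" for i j m
  proof -
    \<comment> \<open>An active composite lies above \<open>V\<close> and touches it at
      \<open>w\<close>, so it inherits the local minimum.\<close>
    have "composite (fs i) (gs j) (hs m) w = V w"
      using that(4) by (simp add: V_def composite_def D_real_def D_ereal_def)
    then show ?thesis
      using w V_le[OF that(1-3)] unfolding local_minimum_def eff_dom_def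
      by (auto elim!: eventually_mono intro: order_trans)
  qed

  obtain \<delta> where \<delta>: "\<delta> > 0" "\<And>z. dist z w < \<delta> \<Longrightarrow> V w \<le> V z"
    using w unfolding local_minimum_def eventually_nhds_metric by auto
  \<comment> \<open>Chosen so that at distance \<open>\<delta>\<close> the parabola has dropped by
    \<open>\<bar>c - b\<bar>\<close>, hence to \<open>b\<close> or below. Closer to
    \<open>w\<close>, it stays below \<open>c\<close>, and local minimality suffices.\<close>
  define a where "a = \<bar>c - b\<bar> / \<delta>\<^sup>2"
  have a: "a \<ge> 0" by (simp add: a_def)
  have minor: "ereal (c - a * (norm (z - w))\<^sup>2) \<le> V z" for z
  proof (cases "dist z w < \<delta>")
    case True
    have "ereal (c - a * (norm (z - w))\<^sup>2) \<le> ereal c" using a by simp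
    then show ?thesis using \<delta>(2)[OF True] c by order
  next
    case False
    then have "\<delta>\<^sup>2 \<le> (norm (z - w))\<^sup>2"
      using \<delta>(1) by (intro power_mono) (auto simp: dist_norm)
    then have "a * \<delta>\<^sup>2 \<le> a * (norm (z - w))\<^sup>2" using a by (intro mult_left_mono)
    moreover have "a * \<delta>\<^sup>2 = \<bar>c - b\<bar>" using \<delta>(1) by (simp add: a_def)
    ultimately have "ereal (c - a * (norm (z - w))\<^sup>2) \<le> ereal b" by simp
    then show ?thesis using b[of z] by (rule order_trans)
  qed
  \<comment> \<open>The inequality \<open>lam \<le> \<epsilon>\<close> gives
    \<open>1 / lam \<ge> L + 2 * a + 1\<close>. The summand 1 provides the strict inequality that
    \<open>T\<close> needs, also at \<open>lam = \<epsilon>\<close>, and keeps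
    \<open>\<epsilon> < 1 / L\<close> when \<open>a = 0\<close>.\<close>
  define \<epsilon> where "\<epsilon> = 1 / (L + 2 * a + 1)"
  have "0 < \<epsilon>" "\<epsilon> < 1 / L"
    using L a by (auto simp: \<epsilon>_def intro!: divide_strict_left_mono)
  moreover have "w \<in> Fix (T_PDMC I fs J gs M hs lam)" if "0 < lam" "lam \<le> \<epsilon>" for lam
  proof -
    have "(L + 2 * a + 1) * lam \<le> 1"
      using that L a by (simp add: \<epsilon>_def field_simps)
    then have "L / 2 + a < 1 / (2 * lam)"
      using that(1) by (simp add: field_simps)
    then show ?thesis using T[OF minor that(1)] by (simp add: Fix_def)
  qed
  ultimately have 2: "\<exists>\<epsilon>. 0 < \<epsilon> \<and> \<epsilon> < 1 / L \<and>
      (\<forall>lam. 0 < lam \<and> ereal lam \<le> min (lambda_bar \<rho>) (ereal \<epsilon>) \<longrightarrow>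
        w \<in> Fix (T_PDMC I fs J gs M hs lam))"
    by auto

  \<comment> \<open>At a global minimum the constant \<open>c\<close> minorizes \<open>V\<close>, so
    \<open>T\<close> applies with \<open>a = 0\<close> and its condition on \<open>lam\<close>
    becomes \<open>lam < 1 / L\<close>.\<close>
  have 3: "T_PDMC I fs J gs M hs lam w = {w}"
    if "global_minimum V w" "0 < lam" "lam < 1 / L" for lam
    using that c L by (intro T[of 0]) (auto simp: global_minimum_def field_simps)

  show ?thesis
    using 1 2 3 by (auto simp: Fix_def is_singleton_def)
qed

end
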